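(* Let $k\ge 1$ be an integer and let $G$ be a graph of order $n$. Then $$L_k(G)+L_k(\overline{G})\leq \begin{cases} 2n & \text{if } k\geq \max\{\Delta(G),\Delta(\overline{G})\}+1,\\ n+2k-2 & \text{if } k\leq \min\{\Delta(G),\Delta(\overline{G})\},\\ 2n-1 & \text{otherwise.}\end{cases}$$ Moreover, the upper bounds are tight: for each of the three cases there exist $k$ and $G$ satisfying the condition of that case for which equality holds in the corresponding bound.
   Context: All graphs are finite, undirected, simple and nontrivial (at least two vertices). $\overline{G}$ is the complement of $G$, $\Delta(G)$ the maximum degree, and $N[v]=\{v\}\cup N(v)$ the closed neighbourhood of $v$. For an integer $k\ge 1$, a set $B\subseteq V(G)$ is a $k$-limited packing if $|N[v]\cap B|\le k$ for every vertex $v$ of $G$; $L_k(G)$ is the maximum cardinality of a $k$-limited packing in $G$. *)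

theory Defs
  imports "HOL-Library.Ramsey"
begin

text \<open>
  A graph is given by its vertex set and a set of two-element subsets of it.
  Graphs are finite and nontrivial, i.e. have at least two vertices.
\<close>

definition simple_graph :: "'a set \<Rightarrow> 'a set set \<Rightarrow> bool" where
  "simple_graph V E \<longleftrightarrow> finite V \<and> 2 \<le> card V \<and> E \<subseteq> [V]\<^bsup>2\<^esup>"

definition complement_edges :: "'a set \<Rightarrow> 'a set set \<Rightarrow> 'a set set" where
  "complement_edges V E = [V]\<^bsup>2\<^esup> - E"

definition neighbourhood :: "'a set \<Rightarrow> 'a set set \<Rightarrow> 'a \<Rightarrow> 'a set" where
  "neighbourhood V E v = {u \<in> V. {u, v} \<in> E}"

definition closed_neighbourhood :: "'a set \<Rightarrow> 'a set set \<Rightarrow> 'a \<Rightarrow> 'a set" where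
  "closed_neighbourhood V E v = insert v (neighbourhood V E v)"

definition degree :: "'a set \<Rightarrow> 'a set set \<Rightarrow> 'a \<Rightarrow> nat" where
  "degree V E v = card (neighbourhood V E v)"

definition max_degree :: "'a set \<Rightarrow> 'a set set \<Rightarrow> nat" where
  "max_degree V E = Max (degree V E ` V)"

definition limited_packing :: "nat \<Rightarrow> 'a set \<Rightarrow> 'a set set \<Rightarrow> 'a set \<Rightarrow> bool" where
  "limited_packing k V E B \<longleftrightarrow>
     B \<subseteq> V \<and> (\<forall>v\<in>V. card (closed_neighbourhood V E v \<inter> B) \<le> k)"

text \<open>
  For finite \<open>V\<close> the maximum is over a finite set, which is nonempty since the
  empty set is always a \<open>k\<close>-limited packing.
\<close>

definition limited_packing_number :: "nat \<Rightarrow> 'a set \<Rightarrow> 'a set set \<Rightarrow> nat" where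
  "limited_packing_number k V E = Max (card ` {B. limited_packing k V E B})"

end

theory Submission
  imports Defs
begin

text \<open>
  Let \<open>B\<close> and \<open>C\<close> be \<open>k\<close>-limited packings of \<open>G\<close> and of its complement, and let
  \<open>I = B \<inter> C\<close>.  For \<open>v \<in> I\<close> the two closed neighbourhoods of \<open>v\<close> cover \<open>V\<close> and share only \<open>v\<close>,
  so \<open>card I + 1 \<le> 2 * k\<close> and \<open>card B + card C = card (B \<union> C) + card I \<le> n + 2 * k - 1\<close>.
  In case of equality \<open>B \<union> C = V\<close>, and each \<open>v \<in> I\<close> already has \<open>k\<close> closed neighbours in \<open>I\<close>, in
  \<open>G\<close> as well as in the complement; so \<open>v\<close> is adjacent in \<open>G\<close> to all of \<open>C - I\<close> and to none of
  \<open>B - I\<close>.  If \<open>k\<close> is at most both maximum degrees, there are \<open>x \<in> V - B\<close> and \<open>y \<in> V - C\<close>.  If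
  they are adjacent, then \<open>x\<close> has all \<open>2 * k\<close> elements of \<open>insert y I\<close> as neighbours in \<open>B\<close>;
  otherwise \<open>y\<close> has all of \<open>insert x I\<close> as neighbours in \<open>C\<close> in the complement.  Both are absurd.
\<close>

section \<open>Closed neighbourhoods in a graph and its complement\<close>

lemma closed_neighbourhood_subset:
  "v \<in> V \<Longrightarrow> closed_neighbourhood V E v \<subseteq> V"
  by (auto simp: closed_neighbourhood_def neighbourhood_def)

lemma closed_neighbourhood_sym:
  "\<lbrakk>u \<in> V; v \<in> V\<rbrakk> \<Longrightarrow> u \<in> closed_neighbourhood V E v \<longleftrightarrow> v \<in> closed_neighbourhood V E u"
  by (auto simp: closed_neighbourhood_def neighbourhood_def insert_commute)

lemma neighbourhood_complement_edges:
  assumes "v \<in> V"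
  shows "neighbourhood V (complement_edges V E) v = V - closed_neighbourhood V E v"
  using assms
  by (auto simp: neighbourhood_def closed_neighbourhood_def complement_edges_def nsets_def
      card_insert_if split: if_splits)

lemma card_closed_neighbourhood:
  assumes "finite V" "E \<subseteq> [V]\<^bsup>2\<^esup>"
  shows "card (closed_neighbourhood V E v) = degree V E v + 1"
proof -
  have "v \<notin> neighbourhood V E v"
    using assms(2) by (auto simp: neighbourhood_def nsets_def)
  moreover have "finite (neighbourhood V E v)"
    using assms(1) by (simp add: neighbourhood_def)
  ultimately show ?thesis
    by (simp add: closed_neighbourhood_def degree_def)
qed

lemma simple_graph_complement:
  "simple_graph V E \<Longrightarrow> simple_graph V (complement_edges V E)"
  by (auto simp: simple_graph_def complement_edges_def)

section \<open>Packing numbers of a single graph\<close>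

lemma limited_packing_number_ge:
  assumes "finite V" "limited_packing k V E B"
  shows "card B \<le> limited_packing_number k V E"
proof -
  have "finite {B. limited_packing k V E B}"
    by (rule finite_subset[of _ "Pow V"]) (auto simp: limited_packing_def assms(1))
  then show ?thesis
    using assms(2) by (auto simp: limited_packing_number_def intro!: Max_ge)
qed

lemma limited_packing_number_attained:
  assumes "finite V"
  obtains B where "limited_packing k V E B" "card B = limited_packing_number k V E"
proof -
  have "finite {B. limited_packing k V E B}"
    by (rule finite_subset[of _ "Pow V"]) (auto simp: limited_packing_def assms)
  moreover have "limited_packing k V E {}"
    by (simp add: limited_packing_def)
  ultimately have "limited_packing_number k V E \<in> card ` {B. limited_packing k V E B}"
    unfolding limited_packing_number_def by (intro Max_in) auto
  then show ?thesis
    using that by auto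
qed

text \<open>Closed neighbourhoods lie in \<open>V\<close>, so the packing condition for
  \<open>V\<close> itself bounds every degree plus one by \<open>k\<close>. The contrapositive is
  what gets used: once \<open>k\<close> is at most the maximum degree, every packing misses a
  vertex.\<close>

lemma limited_packing_vertices_imp_max_degree_less:
  assumes "simple_graph V E" "limited_packing k V E V"
  shows "max_degree V E < k"
proof -
  have "finite V" "V \<noteq> {}" and E: "E \<subseteq> [V]\<^bsup>2\<^esup>"
    using assms(1) by (auto simp: simple_graph_def)
  moreover have "degree V E v < k" if "v \<in> V" for v
  proof -
    have "closed_neighbourhood V E v \<inter> V = closed_neighbourhood V E v"
      using closed_neighbourhood_subset[OF that, of E] by auto
    then have "card (closed_neighbourhood V E v) \<le> k"
      using assms(2) that by (auto simp: limited_packing_def)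
    then show ?thesis
      by (simp add: card_closed_neighbourhood[OF \<open>finite V\<close> E])
  qed
  ultimately show ?thesis
    by (simp add: max_degree_def)
qed

lemma limited_packing_number_le:
  assumes "finite V"
  shows "limited_packing_number k V E \<le> card V"
proof -
  obtain B where "limited_packing k V E B" "card B = limited_packing_number k V E"
    using limited_packing_number_attained[OF assms] .
  then show ?thesis
    using assms card_mono[of V B] by (auto simp: limited_packing_def)
qed

lemma limited_packing_number_less:
  assumes "simple_graph V E" "k \<le> max_degree V E"
  shows "limited_packing_number k V E < card V"
proof -
  have "finite V"
    using assms(1) by (simp add: simple_graph_def)
  then obtain B where B: "limited_packing k V E B" "card B = limited_packing_number k V E"
    using limited_packing_number_attained by blast
  moreover have "B \<noteq> V"
    using B(1) limited_packing_vertices_imp_max_degree_less[OF assms(1)] assms(2) leD by blast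
  ultimately have "B \<subset> V"
    by (auto simp: limited_packing_def)
  then show ?thesis
    using B(2) psubset_card_mono[OF \<open>finite V\<close>] by metis
qed

section \<open>Upper bounds for a graph together with its complement\<close>

lemma card_limited_packings_complement_le:
  assumes "finite V" "1 \<le> k"
    and B: "limited_packing k V E B" "B \<noteq> V"
    and C: "limited_packing k V (complement_edges V E) C" "C \<noteq> V"
  shows "card B + card C \<le> card V + 2 * k - 2"
proof (rule ccontr)
  assume contr: "\<not> ?thesis"
  define I where "I = B \<inter> C"
  let ?N = "closed_neighbourhood V E"
  let ?M = "closed_neighbourhood V (complement_edges V E)"
  have NB: "card (?N v \<inter> B) \<le> k" and MC: "card (?M v \<inter> C) \<le> k" if "v \<in> V" for v
    using B(1) C(1) that by (auto simp: limited_packing_def)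
  have BC: "B \<subseteq> V" "C \<subseteq> V"
    using B(1) C(1) by (auto simp: limited_packing_def)
  have fin: "finite B" "finite C" "finite I"
    using BC \<open>finite V\<close> by (auto simp: I_def intro: finite_subset)
  have M_eq: "?M v = insert v (V - ?N v)" if "v \<in> V" for v
    using neighbourhood_complement_edges[OF that] by (simp add: closed_neighbourhood_def)
  have sum: "card B + card C = card (B \<union> C) + card I"
    using card_Un_Int[OF fin(1,2)] by (simp add: I_def)
  have un_le: "card (B \<union> C) \<le> card V"
    using BC \<open>finite V\<close> by (intro card_mono) auto
  \<comment> \<open>The extra 1 is \<open>v\<close>, the only vertex counted in both parts.\<close>
  have split: "card I + 1 = card (?N v \<inter> I) + card (?M v \<inter> I)" if "v \<in> I" for v
  proof -
    have "v \<in> V"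
      using that BC by (auto simp: I_def)
    then have "(?N v \<inter> I) \<union> (?M v \<inter> I) = I" "(?N v \<inter> I) \<inter> (?M v \<inter> I) = {v}"
      using that BC M_eq[of v] by (auto simp: I_def closed_neighbourhood_def[of V E])
    then show ?thesis
      using card_Un_Int[of "?N v \<inter> I" "?M v \<inter> I"] fin(3) by simp
  qed
  have NI: "card (?N v \<inter> I) \<le> card (?N v \<inter> B)" and MI: "card (?M v \<inter> I) \<le> card (?M v \<inter> C)" for v
    using fin by (auto simp: I_def intro!: card_mono)
  \<comment> \<open>As \<open>1 \<le> k\<close>, the negated bound makes
    \<open>card B + card C\<close> exceed \<open>card V\<close>, so \<open>B\<close> and
    \<open>C\<close> must overlap.\<close>
  obtain w where w: "w \<in> I"
    using contr sum un_le \<open>1 \<le> k\<close> by fastforce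
  then have "w \<in> V"
    using BC by (auto simp: I_def)
  then have "card I + 1 \<le> 2 * k"
    using split[OF w] NB[of w] MC[of w] NI[of w] MI[of w] by linarith
  \<comment> \<open>The negated bound leaves no slack: \<open>card (B \<union> C) + card I\<close>
    is at least \<open>card V + 2 * k - 1\<close>, the sum of the upper bounds on its two
    terms.\<close>
  then have card_I: "card I + 1 = 2 * k" and "card (B \<union> C) = card V"
    using contr sum un_le \<open>1 \<le> k\<close> by linarith+
  then have cover: "B \<union> C = V"
    using BC \<open>finite V\<close> by (intro card_subset_eq) auto
  \<comment> \<open>The two parts in \<open>split\<close> are at most \<open>k\<close> each and sum
    to \<open>2 * k\<close>, so both equal \<open>k\<close>: the members of \<open>I\<close> alone
    exhaust both packing constraints at \<open>v\<close>.\<close>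
  have sat: "?N v \<inter> B = ?N v \<inter> I" "?M v \<inter> C = ?M v \<inter> I" if "v \<in> I" for v
  proof -
    have "v \<in> V"
      using that BC by (auto simp: I_def)
    then have "card (?N v \<inter> I) = card (?N v \<inter> B)" "card (?M v \<inter> I) = card (?M v \<inter> C)"
      using split[OF that] card_I NB[of v] MC[of v] NI[of v] MI[of v] by linarith+
    moreover have "?N v \<inter> I \<subseteq> ?N v \<inter> B" "?M v \<inter> I \<subseteq> ?M v \<inter> C"
      by (auto simp: I_def)
    ultimately show "?N v \<inter> B = ?N v \<inter> I" "?M v \<inter> C = ?M v \<inter> I"
      using fin by (metis card_subset_eq finite_Int)+
  qed
  obtain x y where x: "x \<in> C" "x \<notin> B" and y: "y \<in> B" "y \<notin> C"
    using BC B(2) C(2) cover by blast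
  have "x \<in> V" "y \<in> V" "x \<notin> I" "y \<notin> I"
    using x y BC by (auto simp: I_def)
  \<comment> \<open>By \<open>sat\<close>, a vertex of \<open>C\<close> outside \<open>I\<close> is
    in no \<open>?M v\<close> with \<open>v \<in> I\<close>, hence in every such
    \<open>?N v\<close>. The argument for \<open>y\<close> is the mirror image.\<close>
  have Ix: "I \<subseteq> ?N x"
  proof
    fix v assume "v \<in> I"
    then have "v \<in> V" "x \<notin> ?M v"
      using BC sat(2)[of v] x \<open>x \<notin> I\<close> by (auto simp: I_def)
    then have "x \<in> ?N v"
      using M_eq \<open>x \<in> V\<close> by auto
    then show "v \<in> ?N x"
      using closed_neighbourhood_sym \<open>x \<in> V\<close> \<open>v \<in> V\<close> by metis
  qed
  have Iy: "I \<subseteq> ?M y"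
  proof
    fix v assume "v \<in> I"
    then have "v \<in> V" "y \<notin> ?N v"
      using BC sat(1)[of v] y \<open>y \<notin> I\<close> by (auto simp: I_def)
    then have "y \<in> ?M v"
      using M_eq \<open>y \<in> V\<close> by auto
    then show "v \<in> ?M y"
      using closed_neighbourhood_sym \<open>y \<in> V\<close> \<open>v \<in> V\<close> by metis
  qed
  \<comment> \<open>This exceeds the allowed \<open>k\<close> because
    \<open>1 \<le> k\<close>.\<close>
  have card_ins: "card (insert z I) = 2 * k" if "z \<notin> I" for z
    using that fin(3) card_I by simp
  show False
  proof (cases "y \<in> ?N x")
    case True
    then have "insert y I \<subseteq> ?N x \<inter> B"
      using Ix y by (auto simp: I_def)
    then have "2 * k \<le> card (?N x \<inter> B)"
      using card_mono[of "?N x \<inter> B" "insert y I"] fin card_ins[OF \<open>y \<notin> I\<close>] by simp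
    then show False
      using NB[OF \<open>x \<in> V\<close>] \<open>1 \<le> k\<close> by linarith
  next
    case False
    then have "x \<in> ?M y"
      using M_eq[OF \<open>y \<in> V\<close>] closed_neighbourhood_sym[OF \<open>x \<in> V\<close> \<open>y \<in> V\<close>] \<open>x \<in> V\<close> by blast
    then have "insert x I \<subseteq> ?M y \<inter> C"
      using Iy x by (auto simp: I_def)
    then have "2 * k \<le> card (?M y \<inter> C)"
      using card_mono[of "?M y \<inter> C" "insert x I"] fin card_ins[OF \<open>x \<notin> I\<close>] by simp
    then show False
      using MC[OF \<open>y \<in> V\<close>] \<open>1 \<le> k\<close> by linarith
  qed
qed

lemma limited_packing_number_complement_le:
  assumes G: "simple_graph V E" and "1 \<le> k"
    and k: "k \<le> max_degree V E" "k \<le> max_degree V (complement_edges V E)"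
  shows "limited_packing_number k V E + limited_packing_number k V (complement_edges V E)
    \<le> card V + 2 * k - 2"
proof -
  have "finite V"
    using G by (simp add: simple_graph_def)
  then obtain B C where B: "limited_packing k V E B" "card B = limited_packing_number k V E"
    and C: "limited_packing k V (complement_edges V E) C"
      "card C = limited_packing_number k V (complement_edges V E)"
    using limited_packing_number_attained by metis
  have "B \<noteq> V" "C \<noteq> V"
    using limited_packing_number_less[OF G k(1)]
      limited_packing_number_less[OF simple_graph_complement[OF G] k(2)] B(2) C(2) by auto
  then show ?thesis
    using card_limited_packings_complement_le[OF \<open>finite V\<close> \<open>1 \<le> k\<close> B(1) _ C(1)] B(2) C(2) by simp
qed

lemma limited_packing_number_sum_le:
  assumes G: "simple_graph V E" and "1 \<le> k"
  shows "limited_packing_number k V E + limited_packing_number k V (complement_edges V E)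
        \<le> (if k \<ge> max (max_degree V E) (max_degree V (complement_edges V E)) + 1
              then 2 * card V
            else if k \<le> min (max_degree V E) (max_degree V (complement_edges V E))
              then card V + 2 * k - 2
            else 2 * card V - 1)"
proof -
  let ?E' = "complement_edges V E"
  have "finite V"
    using G by (simp add: simple_graph_def)
  note le = limited_packing_number_le[OF this, of k E] limited_packing_number_le[OF this, of k ?E']
  note less = limited_packing_number_less[OF G]
    limited_packing_number_less[OF simple_graph_complement[OF G]]
  consider "k \<ge> max (max_degree V E) (max_degree V ?E') + 1"
    | "k \<le> max_degree V E" "k \<le> max_degree V ?E'"
    | "\<not> k \<ge> max (max_degree V E) (max_degree V ?E') + 1"
      "\<not> k \<le> min (max_degree V E) (max_degree V ?E')"
    by linarith
  then show ?thesis
  proof cases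
    case 1
    then show ?thesis
      using le by simp
  next
    case 2
    then have "\<not> k \<ge> max (max_degree V E) (max_degree V ?E') + 1"
      by simp
    then show ?thesis
      using limited_packing_number_complement_le[OF G \<open>1 \<le> k\<close> 2] 2 by simp
  next
    case 3
    \<comment> \<open>Failure of the first condition makes one of the two packing numbers smaller
      than \<open>card V\<close>, which saves the 1 in the bound.\<close>
    then have "k \<le> max_degree V E \<or> k \<le> max_degree V ?E'"
      by linarith
    then have "limited_packing_number k V E < card V \<or> limited_packing_number k V ?E' < card V"
      using less by blast
    then have "limited_packing_number k V E + limited_packing_number k V ?E' \<le> 2 * card V - 1"
      using le by linarith
    then show ?thesis
      by (simp only: 3 if_False)
  qed
qed

section \<open>Examples attaining the three bounds\<close>

text \<open>The complement is a single edge, so the maximum degrees are 0 and 1. With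
  \<open>k = 2 = card V\<close> no set can violate the packing condition, and \<open>V\<close> is a
  packing in both graphs.\<close>

lemma two_isolated_vertices_tight:
  fixes V :: "nat set"
  defines "V \<equiv> {0, 1}"
  defines "E' \<equiv> complement_edges V {}"
  shows "simple_graph V {}" "max (max_degree V {}) (max_degree V E') + 1 \<le> 2"
    "limited_packing_number 2 V {} + limited_packing_number 2 V E' = 2 * card V"
proof -
  show G: "simple_graph V {}"
    by (simp add: simple_graph_def V_def)
  have N: "neighbourhood V {} v = {}" for v
    by (simp add: neighbourhood_def)
  have N': "neighbourhood V E' v = V - {v}" if "v \<in> V" for v
    using neighbourhood_complement_edges[OF that] N by (simp add: E'_def closed_neighbourhood_def)
  show D: "max (max_degree V {}) (max_degree V E') + 1 \<le> 2"
    using N N' by (simp add: max_degree_def degree_def V_def)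
  have "card (X \<inter> V) \<le> 2" for X
    using card_mono[of V "X \<inter> V"] by (simp add: V_def)
  then have "limited_packing 2 V {} V" "limited_packing 2 V E' V"
    by (simp_all add: limited_packing_def)
  moreover have "finite V"
    by (simp add: V_def)
  ultimately have "2 * card V \<le> limited_packing_number 2 V {} + limited_packing_number 2 V E'"
    unfolding mult_2 by (intro add_mono limited_packing_number_ge)
  then show "limited_packing_number 2 V {} + limited_packing_number 2 V E' = 2 * card V"
    using limited_packing_number_sum_le[OF G, of 2] D by (simp add: E'_def)
qed

text \<open>The complement is a path with centre 2, so both maximum degrees are at least 1. For
  \<open>k = 1\<close> the bound is 3, reached by \<open>{0, 2}\<close>, one end of the edge with
  the isolated vertex, and a singleton in the complement.\<close>

lemma edge_and_isolated_vertex_tight: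
  fixes V :: "nat set"
  defines "V \<equiv> {0, 1, 2}"
  defines "E \<equiv> {{0, 1}}"
  defines "E' \<equiv> complement_edges V E"
  shows "simple_graph V E" "1 \<le> min (max_degree V E) (max_degree V E')"
    "limited_packing_number 1 V E + limited_packing_number 1 V E' = card V + 2 * 1 - 2"
proof -
  show G: "simple_graph V E"
    by (auto simp: simple_graph_def V_def E_def nsets_def)
  have N: "neighbourhood V E 0 = {1}" "neighbourhood V E 1 = {0}" "neighbourhood V E 2 = {}"
    by (auto simp: neighbourhood_def V_def E_def doubleton_eq_iff)
  have N': "neighbourhood V E' 0 = {2}" "neighbourhood V E' 1 = {2}" "neighbourhood V E' 2 = {0, 1}"
    using N neighbourhood_complement_edges[of 0 V E]
      neighbourhood_complement_edges[of 1 V E]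
      neighbourhood_complement_edges[of 2 V E]
    by (simp_all add: E'_def closed_neighbourhood_def V_def insert_Diff_if)
  show D: "1 \<le> min (max_degree V E) (max_degree V E')"
    unfolding max_degree_def degree_def using N N' by (simp add: V_def)
  have "limited_packing 1 V E {0, 2}" "limited_packing 1 V E' {0}"
    unfolding limited_packing_def closed_neighbourhood_def
    using N N' by (simp_all add: V_def)
  moreover have "finite V"
    by (simp add: V_def)
  ultimately have "card {0::nat, 2} + card {0::nat}
      \<le> limited_packing_number 1 V E + limited_packing_number 1 V E'"
    by (intro add_mono limited_packing_number_ge)
  then show "limited_packing_number 1 V E + limited_packing_number 1 V E' = card V + 2 * 1 - 2"
    using limited_packing_number_complement_le[OF G, of 1] D by (simp add: E'_def V_def)
qed

text \<open>The maximum degrees are 1 and 0, so \<open>k = 1\<close> falls between the other two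
  cases. All of \<open>V\<close> is a packing in the edgeless complement, while the edge admits only
  one vertex: 2 + 1 = 3.\<close>

lemma single_edge_tight:
  fixes V :: "nat set"
  defines "V \<equiv> {0, 1}"
  defines "E \<equiv> {{0, 1}}"
  defines "E' \<equiv> complement_edges V E"
  shows "simple_graph V E"
    "\<not> max (max_degree V E) (max_degree V E') + 1 \<le> 1"
    "\<not> 1 \<le> min (max_degree V E) (max_degree V E')"
    "limited_packing_number 1 V E + limited_packing_number 1 V E' = 2 * card V - 1"
proof -
  show G: "simple_graph V E"
    by (auto simp: simple_graph_def V_def E_def nsets_def)
  have N: "neighbourhood V E 0 = {1}" "neighbourhood V E 1 = {0}"
    by (auto simp: neighbourhood_def V_def E_def doubleton_eq_iff)
  have N': "neighbourhood V E' 0 = {}" "neighbourhood V E' 1 = {}"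
    using N neighbourhood_complement_edges[of 0 V E]
      neighbourhood_complement_edges[of 1 V E]
    by (simp_all add: E'_def closed_neighbourhood_def V_def insert_Diff_if)
  have "max_degree V E = 1" "max_degree V E' = 0"
    unfolding max_degree_def degree_def
    using N N' by (simp_all add: V_def)
  then show D: "\<not> max (max_degree V E) (max_degree V E') + 1 \<le> 1"
      "\<not> 1 \<le> min (max_degree V E) (max_degree V E')"
    by simp_all
  have "limited_packing 1 V E {0}" "limited_packing 1 V E' V"
    unfolding limited_packing_def closed_neighbourhood_def
    using N N' by (simp_all add: V_def)
  moreover have "finite V"
    by (simp add: V_def)
  ultimately have "card {0::nat} + card V
      \<le> limited_packing_number 1 V E + limited_packing_number 1 V E'"
    by (intro add_mono limited_packing_number_ge)
  then have "2 * card V - 1 \<le> limited_packing_number 1 V E + limited_packing_number 1 V E'"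
    by (simp add: V_def)
  moreover have "limited_packing_number 1 V E + limited_packing_number 1 V E' \<le> 2 * card V - 1"
    using limited_packing_number_sum_le[OF G le_refl, folded E'_def] by (simp only: D if_False)
  ultimately show "limited_packing_number 1 V E + limited_packing_number 1 V E' = 2 * card V - 1"
    by (rule antisym[rotated])
qed

theorem theorem3p13:
  shows
    "(\<forall>(V :: 'a set) E k. simple_graph V E \<and> 1 \<le> k \<longrightarrow>
        limited_packing_number k V E + limited_packing_number k V (complement_edges V E)
        \<le> (if k \<ge> max (max_degree V E) (max_degree V (complement_edges V E)) + 1
              then 2 * card V
            else if k \<le> min (max_degree V E) (max_degree V (complement_edges V E))
              then card V + 2 * k - 2
            else 2 * card V - 1))
     \<and> (\<exists>(V :: nat set) E k. simple_graph V E \<and> 1 \<le> k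
          \<and> k \<ge> max (max_degree V E) (max_degree V (complement_edges V E)) + 1
          \<and> limited_packing_number k V E + limited_packing_number k V (complement_edges V E)
              = 2 * card V)
     \<and> (\<exists>(V :: nat set) E k. simple_graph V E \<and> 1 \<le> k
          \<and> k \<le> min (max_degree V E) (max_degree V (complement_edges V E))
          \<and> limited_packing_number k V E + limited_packing_number k V (complement_edges V E)
              = card V + 2 * k - 2)
     \<and> (\<exists>(V :: nat set) E k. simple_graph V E \<and> 1 \<le> k
          \<and> \<not> k \<ge> max (max_degree V E) (max_degree V (complement_edges V E)) + 1
          \<and> \<not> k \<le> min (max_degree V E) (max_degree V (complement_edges V E))
          \<and> limited_packing_number k V E + limited_packing_number k V (complement_edges V E)
              = 2 * card V - 1)"
proof (intro conjI)
  show "\<forall>(V :: 'a set) E k. simple_graph V E \<and> 1 \<le> k \<longrightarrow>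
        limited_packing_number k V E + limited_packing_number k V (complement_edges V E)
        \<le> (if k \<ge> max (max_degree V E) (max_degree V (complement_edges V E)) + 1
              then 2 * card V
            else if k \<le> min (max_degree V E) (max_degree V (complement_edges V E))
              then card V + 2 * k - 2
            else 2 * card V - 1)"
    using limited_packing_number_sum_le by blast
qed (use two_isolated_vertices_tight one_le_numeral in blast,
     use edge_and_isolated_vertex_tight in blast,
     use single_edge_tight in blast)

end
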